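(* Let $p_1,\ldots,p_m$ be $m$ distinct primes and $k_1,\ldots,k_m$ positive integers, and suppose $n=p_1^{k_1}p_2^{k_2}\cdots p_m^{k_m}$ satisfies Robin's inequality $\sigma(n) < e^{\gamma} n\log\log n$. Let $P_1,\ldots,P_m$ be distinct primes with $p_j\le P_j$ for every $j=1,\ldots,m$. Then $N=P_1^{k_1}P_2^{k_2}\cdots P_m^{k_m}$ also satisfies Robin's inequality, i.e. $\sigma(N) < e^{\gamma} N\log\log N$.
   Context: $\sigma(n)$ denotes the sum of the positive divisors of $n$, $\gamma = 0.5772\ldots$ is the Euler--Mascheroni constant, and $\log$ is the natural logarithm. Robin's inequality for $n$ is the strict inequality $\sigma(n) < e^{\gamma} n\log\log n$. *)

theory Defs
  imports "HOL-Analysis.Analysis" "HOL-Computational_Algebra.Primes"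
begin

definition sigma :: "nat \<Rightarrow> nat" where
  "sigma n = (\<Sum>d | d dvd n. d)"

(* log log n is undefined for n = 1; here ln (ln 1) = ln 0 = 0, so the inequality is false at 1. *)
definition robin_inequality :: "nat \<Rightarrow> bool" where
  "robin_inequality n \<longleftrightarrow>
     real (sigma n) < exp euler_mascheroni * real n * ln (ln (real n))"

end

theory Submission
  imports Defs
begin

text \<open>
  The ratio \<open>\<sigma>(n)/n\<close> is the product of the factors \<open>1 + 1/p + \<dots> + 1/p\<^sup>k\<close> over the prime powers
  exactly dividing \<open>n\<close>, so it does not increase when each prime is replaced by a larger one (distinct
  primes staying distinct), while \<open>log log n\<close> does not decrease.
\<close>

text \<open>Multiplication matches pairs of divisors of \<open>a\<close> and \<open>b\<close> with
  divisors of \<open>a * b\<close>. Coprimality makes this injective: the pair is recovered from the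
  product by taking the gcd with \<open>a\<close> and with \<open>b\<close>.\<close>

lemma sigma_mult_coprime:
  assumes "coprime a b"
  shows "sigma (a * b) = sigma a * sigma b"
proof -
  have recover: "gcd (d * e) a = d" "gcd (d * e) b = e" if "d dvd a" "e dvd b" for d e
  proof -
    have "coprime a e" "coprime b d"
      using coprime_divisors[OF dvd_refl that(2) assms] coprime_divisors[OF that(1) dvd_refl assms]
      by (simp_all add: coprime_commute)
    then have "gcd (d * e) a = gcd d a" "gcd (d * e) b = gcd e b"
      by (simp_all add: gcd_mult_right_right_cancel gcd_mult_right_left_cancel gcd.commute)
    then show "gcd (d * e) a = d" "gcd (d * e) b = e"
      using that by (simp_all add: gcd_nat.absorb1)
  qed
  have "bij_betw (\<lambda>(d, e). d * e) ({d. d dvd a} \<times> {e. e dvd b}) {d. d dvd a * b}"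
    unfolding bij_betw_def
  proof
    show "inj_on (\<lambda>(d, e). d * e) ({d. d dvd a} \<times> {e. e dvd b})"
      by (rule inj_on_inverseI[where g = "\<lambda>x. (gcd x a, gcd x b)"]) (auto simp: recover)
    show "(\<lambda>(d, e). d * e) ` ({d. d dvd a} \<times> {e. e dvd b}) = {d. d dvd a * b}"
    proof
      show "{d. d dvd a * b} \<subseteq> (\<lambda>(d, e). d * e) ` ({d. d dvd a} \<times> {e. e dvd b})"
      proof
        fix x assume "x \<in> {d. d dvd a * b}"
        then obtain d e where "x = d * e" "d dvd a" "e dvd b"
          using division_decomp[of x a b] by blast
        then show "x \<in> (\<lambda>(d, e). d * e) ` ({d. d dvd a} \<times> {e. e dvd b})"
          by (intro image_eqI[where x = "(d, e)"]) simp_all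
      qed
    qed (auto intro: mult_dvd_mono)
  qed
  then have "sigma (a * b) = (\<Sum>(d, e)\<in>{d. d dvd a} \<times> {e. e dvd b}. d * e)"
    unfolding sigma_def
    by (subst sum.reindex_bij_betw[symmetric]) (auto simp: case_prod_unfold)
  also have "\<dots> = sigma a * sigma b"
    by (simp add: sigma_def sum_product sum.cartesian_product)
  finally show ?thesis .
qed

lemma sigma_prod_coprime:
  assumes "finite A" "\<And>i j. i \<in> A \<Longrightarrow> j \<in> A \<Longrightarrow> i \<noteq> j \<Longrightarrow> coprime (f i) (f j)"
  shows "sigma (\<Prod>i\<in>A. f i) = (\<Prod>i\<in>A. sigma (f i))"
  using assms
proof (induction A rule: finite_induct)
  case empty
  show ?case by (simp add: sigma_def)
next
  case (insert x A)
  then have "coprime (f x) (\<Prod>i\<in>A. f i)"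
    by (intro prod_coprime_right) auto
  with insert show ?case by (simp add: sigma_mult_coprime)
qed

lemma sigma_prime_power:
  assumes "prime p"
  shows "sigma (p ^ k) = (\<Sum>i\<le>k. p ^ i)"
proof -
  have "{d. d dvd p ^ k} = (\<lambda>i. p ^ i) ` {..k}"
    using assms by (auto simp: divides_primepow_nat)
  moreover have "inj_on (\<lambda>i. p ^ i) {..k}"
    using prime_gt_1_nat[OF assms] by (simp add: inj_on_def)
  ultimately show ?thesis by (simp add: sigma_def sum.reindex)
qed

text \<open>Cross-multiplied form, kept in the naturals, of the fact that
  \<open>1 + 1/p + ... + 1/p^k\<close> does not increase with \<open>p\<close>. The geometric sums
  are compared term by term.\<close>

lemma sigma_prime_power_ratio_antimono:
  assumes "prime p" "prime q" "p \<le> q"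
  shows "sigma (q ^ k) * p ^ k \<le> sigma (p ^ k) * q ^ k"
proof -
  have "q ^ i * p ^ k \<le> p ^ i * q ^ k" if "i \<le> k" for i
  proof -
    \<comment> \<open>Both sides of the goal share the factor \<open>p ^ i * q ^ i\<close>; what
      remains is \<open>p ^ (k - i)\<close> against \<open>q ^ (k - i)\<close>.\<close>
    have "p ^ i * q ^ i * p ^ (k - i) \<le> p ^ i * q ^ i * q ^ (k - i)"
      using assms by (intro mult_left_mono power_mono) auto
    moreover have "x ^ k = x ^ i * x ^ (k - i)" for x :: nat
      using that by (simp flip: power_add)
    ultimately show ?thesis by (metis mult.assoc mult.commute)
  qed
  then show ?thesis
    using assms by (auto simp: sigma_prime_power sum_distrib_right intro: sum_mono)
qed

lemma sigma_prod_prime_powers: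
  assumes "finite A" "\<And>j. j \<in> A \<Longrightarrow> prime (p j)" "inj_on p A"
  shows "sigma (\<Prod>j\<in>A. p j ^ k j) = (\<Prod>j\<in>A. sigma (p j ^ k j))"
  using assms by (intro sigma_prod_coprime) (auto simp: primes_coprime inj_on_eq_iff)

text \<open>The last hypothesis says that the ratio \<open>sigma N / N\<close> is at most
  \<open>sigma n / n\<close>, while the bound \<open>ln (ln n)\<close> can only grow on passing to
  \<open>N\<close>.\<close>

lemma robin_inequality_mono:
  assumes "robin_inequality n" "n \<le> N" "sigma N * n \<le> sigma n * N"
  shows "robin_inequality N"
proof -
  define c where "c = exp (euler_mascheroni :: real)"
  have c: "c > 0" by (simp add: c_def)
  have robin: "real (sigma n) < c * real n * ln (ln (real n))"
    using assms(1) by (simp add: robin_inequality_def c_def)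
  \<comment> \<open>Since \<open>sigma n\<close> is nonnegative, the strict inequality makes the
    right side positive. This yields both \<open>n > 0\<close> and a positive double
    logarithm.\<close>
  then have "0 < (c * real n) * ln (ln (real n))" by linarith
  moreover have "0 \<le> c * real n" using c by simp
  ultimately have "0 < c * real n" and lnln: "ln (ln (real n)) > 0"
    by (auto simp: zero_less_mult_iff)
  then have n: "n > 0"
    using c by (simp add: zero_less_mult_iff)
  \<comment> \<open>From \<open>n > 0\<close> only \<open>ln n \<ge> 0\<close> follows. Equality is
    excluded because \<open>ln 0 = 0\<close> would contradict \<open>lnln\<close>. Positivity is
    what the monotonicity of the outer logarithm requires.\<close>
  then have "ln (real n) > 0"
    using lnln ln_ge_zero[of "real n"] by (cases "ln (real n) = 0") auto
  then have mono: "ln (ln (real n)) \<le> ln (ln (real N))"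
    using n assms(2) by (smt (verit) ln_le_cancel_iff of_nat_0_less_iff of_nat_mono)
  have "real (sigma N) * real n \<le> real (sigma n) * real N"
    using assms(3) by (metis of_nat_le_iff of_nat_mult)
  also have "\<dots> < c * real n * ln (ln (real n)) * real N"
    using robin n assms(2) by simp
  also have "\<dots> \<le> c * real n * ln (ln (real N)) * real N"
    using mono c by (intro mult_right_mono mult_left_mono) auto
  also have "\<dots> = (c * real N * ln (ln (real N))) * real n"
    by simp
  finally show ?thesis
    using n by (simp add: robin_inequality_def c_def)
qed

theorem theorem2p2:
  fixes m n N :: nat and p P k :: "nat \<Rightarrow> nat"
  assumes "\<And>j. j \<in> {1..m} \<Longrightarrow> prime (p j)"
    and "inj_on p {1..m}"
    and "\<And>j. j \<in> {1..m} \<Longrightarrow> k j > 0"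
    and "n = (\<Prod>j\<in>{1..m}. p j ^ k j)"
    and "robin_inequality n"
    and "\<And>j. j \<in> {1..m} \<Longrightarrow> prime (P j)"
    and "inj_on P {1..m}"
    and "\<And>j. j \<in> {1..m} \<Longrightarrow> p j \<le> P j"
    and "N = (\<Prod>j\<in>{1..m}. P j ^ k j)"
  shows "robin_inequality N"
proof (rule robin_inequality_mono)
  show "robin_inequality n" by fact
  show "n \<le> N"
    unfolding assms(4,9) by (intro prod_mono conjI power_mono assms(8)) auto
  \<comment> \<open>Regrouping by index pairs each \<open>P j\<close> with its own
    \<open>p j\<close>, so the ratio comparison applies factor by factor.\<close>
  have "sigma N * n = (\<Prod>j\<in>{1..m}. sigma (P j ^ k j) * p j ^ k j)"
    unfolding assms(4,9) prod.distrib using assms(6,7) by (subst sigma_prod_prime_powers) auto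
  also have "\<dots> \<le> (\<Prod>j\<in>{1..m}. sigma (p j ^ k j) * P j ^ k j)"
    by (intro prod_mono conjI sigma_prime_power_ratio_antimono assms(1,6,8)) auto
  also have "\<dots> = sigma n * N"
    unfolding assms(4,9) prod.distrib using assms(1,2) by (subst sigma_prod_prime_powers) auto
  finally show "sigma N * n \<le> sigma n * N" .
qed

end
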